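(* Let $X$ and $Y$ be Banach spaces, $U\subset X$ an open set and $T:Y\to X$ a bounded linear operator. Assume that $X$ admits a Lipschitz Gâteaux differentiable bump function $b:X\to\mathbb{R}$. Then $T$ is compact if and only if for every bounded Lipschitz, everywhere Gâteaux differentiable function $f:U\to\mathbb{R}$, $f\circ T$ is everywhere Fréchet differentiable.
   Context: The composition $f\circ T$ is defined on the open set $T^{-1}(U)$. A bump function on $X$ is a nonnegative continuous function $b:X\to\mathbb{R}$, different from $0$, with bounded support, where $\mathrm{supp}(b)=\overline{\{x\in X: b(x)\ne0\}}$. Gâteaux differentiability of a real-valued function $f$ at $x$ means that there is a bounded linear functional $d_Gf(x)$ with $\lim_{t\to0}\frac{f(x+th)-f(x)}{t}=d_Gf(x)h$ for each $h\in X$. Fréchet differentiability means that this limit is uniform for $h$ in the unit ball.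
   Formalization: The preimage of U under T is additionally assumed to be nonempty; otherwise f∘T has empty domain, the differentiability condition holds vacuously, and the "if" direction fails for every noncompact T. *)

theory Defs
  imports "HOL-Analysis.Analysis"
begin

definition gateaux_differentiable_at ::
    "('a::real_normed_vector \<Rightarrow> real) \<Rightarrow> 'a \<Rightarrow> bool" where
  "gateaux_differentiable_at f x \<longleftrightarrow>
     (\<exists>D. bounded_linear D \<and>
          (\<forall>h. ((\<lambda>t::real. (f (x + t *\<^sub>R h) - f x) / t) \<longlongrightarrow> D h) (at 0)))"

definition bump_function :: "('a::real_normed_vector \<Rightarrow> real) \<Rightarrow> bool" where
  "bump_function b \<longleftrightarrow>
     continuous_on UNIV b \<and> (\<forall>x. 0 \<le> b x) \<and> (\<exists>x. b x \<noteq> 0) \<and>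
     bounded (closure {x. b x \<noteq> 0})"

definition compact_operator ::
    "('a::real_normed_vector \<Rightarrow> 'b::real_normed_vector) \<Rightarrow> bool" where
  "compact_operator T \<longleftrightarrow> bounded_linear T \<and> compact (closure (T ` cball 0 1))"

end

theory Submission
  imports Defs
begin

text \<open>
  If \<open>T\<close> is compact, the difference quotients of \<open>f\<close> at \<open>T y\<close> are equi-Lipschitz functions of the
  direction, so their pointwise convergence is uniform on the totally bounded set
  \<open>T ` cball 0 1\<close>.

  If \<open>T\<close> is not compact, the image of the unit ball contains a uniformly separated sequence
  \<open>s n = T (v n)\<close>. Rescale the bump to small disjoint bumps of height comparable to \<open>q ^ n\<close> and
  centred at \<open>q ^ n *\<^sub>R s n\<close>. A line through the origin meets only finitely many of them, so their
  sum has Gateaux derivative \<open>0\<close> at the origin, but it is not \<open>o(q ^ n)\<close> at \<open>T (q ^ n *\<^sub>R v n)\<close>.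
\<close>

section \<open>Gateaux differentiability\<close>

text \<open>Rephrased as one-variable derivatives along lines, so that the rules for
  \<open>has_real_derivative\<close> apply.\<close>

lemma gateaux_differentiable_at_iff_deriv:
  "gateaux_differentiable_at f x \<longleftrightarrow>
     (\<exists>D. bounded_linear D \<and> (\<forall>h. ((\<lambda>t. f (x + t *\<^sub>R h)) has_real_derivative D h) (at 0)))"
  by (simp add: gateaux_differentiable_at_def DERIV_def)

lemma gateaux_differentiable_at_compose_affine:
  assumes "gateaux_differentiable_at f (c *\<^sub>R x + a)"
  shows "gateaux_differentiable_at (\<lambda>x. f (c *\<^sub>R x + a)) x"
proof -
  from assms obtain D where D: "bounded_linear D"
    "\<And>h. ((\<lambda>t. f (c *\<^sub>R x + a + t *\<^sub>R h)) has_real_derivative D h) (at 0)"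
    by (auto simp: gateaux_differentiable_at_iff_deriv)
  have "((\<lambda>t. f (c *\<^sub>R (x + t *\<^sub>R h) + a)) has_real_derivative D (c *\<^sub>R h)) (at 0)" for h
    using D(2)[of "c *\<^sub>R h"] by (simp add: algebra_simps)
  moreover have "bounded_linear (\<lambda>h. D (c *\<^sub>R h))"
    using bounded_linear_compose[OF D(1) bounded_linear_scaleR_right[of c]] by simp
  ultimately show ?thesis
    by (auto simp: gateaux_differentiable_at_iff_deriv intro!: exI[of _ "\<lambda>h. D (c *\<^sub>R h)"])
qed

lemma gateaux_differentiable_at_cmult:
  assumes "gateaux_differentiable_at f x"
  shows "gateaux_differentiable_at (\<lambda>x. c * f x) x"
proof -
  from assms obtain D where "bounded_linear D"
    "\<And>h. ((\<lambda>t. f (x + t *\<^sub>R h)) has_real_derivative D h) (at 0)"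
    by (auto simp: gateaux_differentiable_at_iff_deriv)
  then show ?thesis
    unfolding gateaux_differentiable_at_iff_deriv
    by (intro exI[of _ "\<lambda>h. c * D h"] conjI allI DERIV_cmult bounded_linear_const_mult)
qed

lemma gateaux_differentiable_at_sum:
  assumes "\<And>i. i \<in> I \<Longrightarrow> gateaux_differentiable_at (f i) x"
  shows "gateaux_differentiable_at (\<lambda>x. \<Sum>i\<in>I. f i x) x"
proof -
  from assms obtain D where "\<And>i. i \<in> I \<Longrightarrow> bounded_linear (D i)"
    "\<And>i h. i \<in> I \<Longrightarrow> ((\<lambda>t. f i (x + t *\<^sub>R h)) has_real_derivative D i h) (at 0)"
    unfolding gateaux_differentiable_at_iff_deriv by metis
  then show ?thesis
    unfolding gateaux_differentiable_at_iff_deriv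
    by (intro exI[of _ "\<lambda>h. \<Sum>i\<in>I. D i h"] conjI allI DERIV_sum bounded_linear_sum)
qed

lemma eventually_line_in_open:
  fixes x h :: "'a::real_normed_vector"
  assumes "open S" "x \<in> S"
  shows "\<forall>\<^sub>F t in nhds (0::real). x + t *\<^sub>R h \<in> S"
proof -
  have "((\<lambda>t. x + t *\<^sub>R h) \<longlongrightarrow> x + 0 *\<^sub>R h) (nhds 0)"
    by (intro tendsto_intros filterlim_ident)
  then show ?thesis
    using assms by (auto simp: tendsto_def)
qed

text \<open>Differentiability is local: every line through \<open>x\<close> stays in
  \<open>S\<close> for small parameters, so \<open>f\<close> and \<open>g\<close> agree along it
  near \<open>0\<close>.\<close>

lemma gateaux_differentiable_at_transform_open:
  assumes "gateaux_differentiable_at f x" "open S" "x \<in> S" "\<And>z. z \<in> S \<Longrightarrow> f z = g z"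
  shows "gateaux_differentiable_at g x"
proof -
  from assms(1) obtain D where D: "bounded_linear D"
    "\<And>h. ((\<lambda>t. f (x + t *\<^sub>R h)) has_real_derivative D h) (at 0)"
    by (auto simp: gateaux_differentiable_at_iff_deriv)
  have "((\<lambda>t. g (x + t *\<^sub>R h)) has_real_derivative D h) (at 0)" for h
  proof -
    have "\<forall>\<^sub>F t in nhds 0. f (x + t *\<^sub>R h) = g (x + t *\<^sub>R h)"
      using eventually_line_in_open[OF assms(2,3)] by eventually_elim (use assms(4) in auto)
    then show ?thesis
      using D(2) DERIV_cong_ev[of 0 0 "\<lambda>t. f (x + t *\<^sub>R h)" "\<lambda>t. g (x + t *\<^sub>R h)" "D h" "D h"]
      by simp
  qed
  with D(1) show ?thesis
    by (auto simp: gateaux_differentiable_at_iff_deriv)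
qed

section \<open>Compact operators\<close>

lemma compact_operator_gateaux_imp_differentiable:
  fixes T :: "'y::real_normed_vector \<Rightarrow> 'x::real_normed_vector" and f :: "'x \<Rightarrow> real"
  assumes T: "compact_operator T" and U: "open U" "T y \<in> U"
    and lip: "L-lipschitz_on U f" and gat: "gateaux_differentiable_at f (T y)"
  shows "(f \<circ> T) differentiable (at y)"
proof -
  have blT: "bounded_linear T" and comp: "compact (closure (T ` cball 0 1))"
    using T by (auto simp: compact_operator_def)
  interpret T: bounded_linear T by (fact blT)
  from gat obtain D where D: "bounded_linear D"
    and lim: "\<And>h. ((\<lambda>t. (f (T y + t *\<^sub>R h) - f (T y)) / t) \<longlongrightarrow> D h) (at 0)"
    by (auto simp: gateaux_differentiable_at_def)
  interpret D: bounded_linear D by (fact D)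
  have L: "L \<ge> 0" using lip by (rule lipschitz_on_nonneg)
  obtain C where C: "C > 0" "\<And>h. norm (D h) \<le> norm h * C"
    using D.pos_bounded by blast
  obtain r where r: "r > 0" "\<And>z. dist z y < r \<Longrightarrow> T z \<in> U"
  proof -
    have "open (T -` U)"
      using U(1) T.continuous_on[OF continuous_on_id] by (auto intro: open_vimage)
    moreover have "y \<in> T -` U" using U(2) by simp
    ultimately have "\<exists>r>0. \<forall>z. dist z y < r \<longrightarrow> z \<in> T -` U"
      unfolding open_dist by blast
    then show thesis using that by auto
  qed
  have "(f \<circ> T has_derivative (D \<circ> T)) (at y)"
    unfolding has_derivative_at_alt
  proof (intro conjI allI impI)
    show "bounded_linear (D \<circ> T)"
      using bounded_linear_compose[OF D blT] by (simp add: o_def)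
    fix e :: real assume e: "e > 0"
    \<comment> \<open>With this radius, \<open>(L + C) * \<rho> = e / 2\<close> pays for replacing
      \<open>T u\<close> by a net point in both \<open>f\<close> and \<open>D\<close>. The other
      half of \<open>e\<close> is left for the difference quotient at the net point.\<close>
    define \<rho> where "\<rho> = e / 2 / (L + C)"
    have \<rho>: "\<rho> > 0" using e L C by (simp add: \<rho>_def)
    obtain F where F: "finite F" "closure (T ` cball 0 1) \<subseteq> (\<Union>h\<in>F. ball h \<rho>)"
      by (rule compactE_image[OF comp, of "closure (T ` cball 0 1)" "\<lambda>h. ball h \<rho>"])
      (use \<rho> in force)+
    \<comment> \<open>Membership in \<open>U\<close> is recorded too, since \<open>f\<close> is
      Lipschitz only there.\<close>
    have "\<forall>\<^sub>F t in at 0. \<forall>h\<in>F. T y + t *\<^sub>R h \<in> U \<and>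
        \<bar>(f (T y + t *\<^sub>R h) - f (T y)) / t - D h\<bar> < e / 2"
    proof (intro eventually_ball_finite F(1) ballI eventually_conj)
      fix h
      show "\<forall>\<^sub>F t in at 0. T y + t *\<^sub>R h \<in> U"
        using eventually_line_in_open[OF U] eventually_nhds_conv_at by blast
      show "\<forall>\<^sub>F t in at 0. \<bar>(f (T y + t *\<^sub>R h) - f (T y)) / t - D h\<bar> < e / 2"
        using tendstoD[OF lim, of "e / 2"] e by (simp add: dist_real_def)
    qed
    then obtain d where d: "d > 0" and near: "\<And>t h. \<lbrakk>t \<noteq> 0; \<bar>t\<bar> < d; h \<in> F\<rbrakk> \<Longrightarrow>
        T y + t *\<^sub>R h \<in> U \<and> \<bar>(f (T y + t *\<^sub>R h) - f (T y)) / t - D h\<bar> < e / 2"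
      unfolding eventually_at by (auto simp: dist_real_def)
    show "\<exists>d>0. \<forall>z. norm (z - y) < d \<longrightarrow>
        norm ((f \<circ> T) z - (f \<circ> T) y - (D \<circ> T) (z - y)) \<le> e * norm (z - y)"
    proof (intro exI[of _ "min d r"] conjI allI impI)
      show "min d r > 0" using d r(1) by simp
      fix z assume z: "norm (z - y) < min d r"
      show "norm ((f \<circ> T) z - (f \<circ> T) y - (D \<circ> T) (z - y)) \<le> e * norm (z - y)"
      proof (cases "z = y")
        case True
        then show ?thesis by (simp add: T.zero D.zero)
      next
        case False
        define t u where "t = norm (z - y)" and "u = (z - y) /\<^sub>R t"
        have t: "t > 0" "t < d" "t < r" using False z by (auto simp: t_def)
        have zu: "z = y + t *\<^sub>R u" using t by (simp add: u_def)
        have "norm u \<le> 1" using t by (simp add: u_def t_def)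
        then have "T u \<in> closure (T ` cball 0 1)"
          by (intro subsetD[OF closure_subset]) auto
        then obtain h where h: "h \<in> F" "dist h (T u) < \<rho>" using F(2) by auto
        have Tz: "T z = T y + t *\<^sub>R T u" by (simp add: zu T.add T.scaleR)
        have hu: "T y + t *\<^sub>R h \<in> U" and
          q: "\<bar>(f (T y + t *\<^sub>R h) - f (T y)) / t - D h\<bar> < e / 2"
          using near[of t h] t h by auto
        \<comment> \<open>The error splits in three: moving from \<open>T u\<close> to
          \<open>h\<close> inside \<open>f\<close>, the difference quotient at \<open>h\<close>, and
          moving back from \<open>h\<close> to \<open>T u\<close> inside \<open>D\<close>.\<close>
        have 1: "\<bar>f (T z) - f (T y + t *\<^sub>R h)\<bar> \<le> L * (t * \<rho>)"
        proof -
          have "T z \<in> U" using r(2) t by (simp add: t_def dist_norm)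
          then have "\<bar>f (T z) - f (T y + t *\<^sub>R h)\<bar> \<le> L * dist (T z) (T y + t *\<^sub>R h)"
            using lipschitz_onD[OF lip _ hu] by (simp add: dist_real_def)
          also have "dist (T z) (T y + t *\<^sub>R h) = t * dist h (T u)"
            using t by (simp add: Tz dist_norm norm_minus_commute flip: scaleR_diff_right)
          also have "L * (t * dist h (T u)) \<le> L * (t * \<rho>)"
            using h L t by (intro mult_left_mono) auto
          finally show ?thesis .
        qed
        have 2: "\<bar>f (T y + t *\<^sub>R h) - f (T y) - t * D h\<bar> \<le> t * (e / 2)"
        proof -
          have "f (T y + t *\<^sub>R h) - f (T y) - t * D h =
              t * ((f (T y + t *\<^sub>R h) - f (T y)) / t - D h)"
            using t by (simp add: field_simps)
          then show ?thesis using q t by (simp add: abs_mult)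
        qed
        have 3: "\<bar>t * D h - t * D (T u)\<bar> \<le> t * (\<rho> * C)"
        proof -
          have "\<bar>D h - D (T u)\<bar> \<le> norm (h - T u) * C"
            using C(2)[of "h - T u"] by (simp add: D.diff)
          also have "\<dots> \<le> \<rho> * C" using h C by (simp add: dist_norm)
          finally show ?thesis using t by (simp add: abs_mult flip: right_diff_distrib)
        qed
        have "D (T (z - y)) = t * D (T u)"
          by (simp add: zu T.scaleR D.scaleR)
        then have "\<bar>f (T z) - f (T y) - D (T (z - y))\<bar> \<le>
            L * (t * \<rho>) + t * (e / 2) + t * (\<rho> * C)"
          using 1 2 3 by linarith
        also have "\<dots> = t * ((L + C) * \<rho> + e / 2)" by (simp add: algebra_simps)
        also have "(L + C) * \<rho> = e / 2" using L C(1) by (simp add: \<rho>_def field_simps)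
        finally show ?thesis by (simp add: t_def mult.commute)
      qed
    qed
  qed
  then show ?thesis by (rule differentiableI)
qed

section \<open>Separated sequences and total boundedness\<close>

text \<open>By completeness, the closure fails to be totally bounded, so points far from all earlier
  ones can be chosen forever.\<close>

lemma not_compact_closure_imp_separated_sequence:
  fixes S :: "'a::banach set"
  assumes "\<not> compact (closure S)"
  obtains s :: "nat \<Rightarrow> 'a" and e where "e > 0" "range s \<subseteq> S" "\<And>n. norm (s n) \<ge> e"
    "\<And>m n. m \<noteq> n \<Longrightarrow> dist (s m) (s n) \<ge> e"
proof -
  have "complete (closure S)" by (simp add: complete_eq_closed)
  with assms obtain e where e: "e > 0"
    and nocover: "\<And>k. finite k \<Longrightarrow> \<not> closure S \<subseteq> (\<Union>x\<in>k. ball x e)"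
    unfolding compact_eq_totally_bounded by blast
  have far: "\<exists>s\<in>S. \<forall>x\<in>k. dist x s \<ge> e / 2" if "finite k" for k
  proof (rule ccontr)
    assume "\<not> ?thesis"
    \<comment> \<open>Closed balls of half the radius are used because their finite union is closed,
      so it covers the closure of \<open>S\<close> as well.\<close>
    then have "S \<subseteq> (\<Union>x\<in>k. cball x (e / 2))" by force
    then have "closure S \<subseteq> (\<Union>x\<in>k. cball x (e / 2))"
      using that by (intro closure_minimal closed_UN) auto
    also have "\<dots> \<subseteq> (\<Union>x\<in>k. ball x e)" using e by force
    finally show False using nocover that by blast
  qed
  \<comment> \<open>Adding \<open>0\<close> to the points to be avoided gives the lower bound on the
    norms.\<close>
  have "\<exists>s. \<forall>n::nat. s n \<in> S \<and> (\<forall>x\<in>insert 0 (s ` {..<n}). dist x (s n) \<ge> e / 2)"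
  proof (rule dependent_wellorder_choice)
    fix s :: "nat \<Rightarrow> 'a" and n
    show "\<exists>r. r \<in> S \<and> (\<forall>x\<in>insert 0 (s ` {..<n}). dist x r \<ge> e / 2)"
      using far[of "insert 0 (s ` {..<n})"] by auto
  qed (simp add: image_def)
  then obtain s :: "nat \<Rightarrow> 'a" where "\<forall>n. s n \<in> S \<and>
    (\<forall>x\<in>insert 0 (s ` {..<n}). dist x (s n) \<ge> e / 2)" ..
  then have s: "\<And>n. s n \<in> S" "\<And>n. norm (s n) \<ge> e / 2"
    "\<And>m n. m < n \<Longrightarrow> dist (s m) (s n) \<ge> e / 2"
    by auto
  show thesis
  proof (rule that)
    show "e / 2 > 0" using e by simp
    show "range s \<subseteq> S" using s(1) by auto
    show "norm (s n) \<ge> e / 2" for n by (rule s(2))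
    show "dist (s m) (s n) \<ge> e / 2" if "m \<noteq> n" for m n
      using s(3)[of m n] s(3)[of n m] that by (cases m n rule: linorder_cases) (auto simp: dist_commute)
  qed
qed

text \<open>A ball of radius \<open>e / 2\<close> contains at most one term of the sequence, so
  sending an index to a nearby point of a finite net of \<open>K\<close> is injective. Applied to a
  segment of a line, this shows that the line meets only finitely many bumps.\<close>

lemma separated_sequence_near_compact_finite:
  fixes s :: "nat \<Rightarrow> 'a::metric_space"
  assumes e: "e > 0" and sep: "\<And>m n. m \<noteq> n \<Longrightarrow> dist (s m) (s n) \<ge> e" and K: "compact K"
  shows "finite {n. \<exists>k\<in>K. dist (s n) k < e / 4}"
proof -
  obtain F where F: "finite F" "K \<subseteq> (\<Union>x\<in>F. ball x (e / 4))"
    by (rule compactE_image[OF K, of K "\<lambda>x. ball x (e / 4)"]) (use e in force)+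
  let ?N = "{n. \<exists>k\<in>K. dist (s n) k < e / 4}"
  have "\<forall>n\<in>?N. \<exists>x. x \<in> F \<and> dist (s n) x < e / 2"
  proof
    fix n assume "n \<in> ?N"
    then obtain k where k: "k \<in> K" "dist (s n) k < e / 4" by auto
    with F(2) obtain x where x: "x \<in> F" "dist x k < e / 4" by auto
    have "dist (s n) x < e / 2"
      using dist_triangle2[of "s n" x k] k x by linarith
    with x show "\<exists>x. x \<in> F \<and> dist (s n) x < e / 2" by blast
  qed
  from bchoice[OF this] obtain c where c: "\<forall>n\<in>?N. c n \<in> F \<and> dist (s n) (c n) < e / 2" ..
  have "inj_on c ?N"
  proof (rule inj_onI, rule ccontr)
    fix m n assume mn: "m \<in> ?N" "n \<in> ?N" "c m = c n" "m \<noteq> n"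
    have "dist (s m) (s n) < e"
      using dist_triangle2[of "s m" "s n" "c m"] bspec[OF c mn(1)] bspec[OF c mn(2)] mn(3) by simp
    with sep[OF mn(4)] show False by simp
  qed
  moreover have "c ` ?N \<subseteq> F" using c by auto
  ultimately show ?thesis using F(1) inj_on_finite by blast
qed

section \<open>A sum of bumps shrinking towards the origin\<close>

text \<open>An affine change of variables moves a point \<open>a\<close> with \<open>b a > 0\<close>
  to the origin and shrinks the support. Boundedness follows from the Lipschitz condition on a
  bounded support.\<close>

lemma bump_function_rescale:
  fixes b :: "'x::real_normed_vector \<Rightarrow> real"
  assumes b: "bump_function b" and lip: "L-lipschitz_on UNIV b"
    and gat: "\<And>x. gateaux_differentiable_at b x" and r: "r > 0"
  obtains \<beta> :: "'x \<Rightarrow> real" and L' B where "L'-lipschitz_on UNIV \<beta>"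
    "\<And>x. gateaux_differentiable_at \<beta> x" "\<beta> 0 > 0" "\<And>x. \<beta> x \<noteq> 0 \<Longrightarrow> norm x < r"
    "\<And>x. \<bar>\<beta> x\<bar> \<le> B"
proof -
  from b have nn: "\<And>x. b x \<ge> 0" and "\<exists>x. b x \<noteq> 0" by (auto simp: bump_function_def)
  then obtain a where "b a \<noteq> 0" by blast
  with nn[of a] have a: "b a > 0" by linarith
  have "bounded (closure {x. b x \<noteq> 0})" using b by (simp add: bump_function_def)
  then have "bounded {x. b x \<noteq> 0}" using closure_subset by (rule bounded_subset)
  then obtain R0 where R0: "\<And>x. b x \<noteq> 0 \<Longrightarrow> dist a x \<le> R0"
    unfolding bounded_any_center[of _ a] by auto
  \<comment> \<open>The added \<open>1\<close> makes \<open>R\<close> positive and the distance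
    bound strict.\<close>
  define R where "R = R0 + 1"
  have "R0 \<ge> 0" using R0[of a] a by simp
  with R0 have R: "R > 0" "\<And>x. b x \<noteq> 0 \<Longrightarrow> dist x a < R"
    by (fastforce simp: R_def dist_commute)+
  define c where "c = R / r"
  have c: "c > 0" using R r by (simp add: c_def)
  show thesis
  proof (rule that)
    show "(L * c)-lipschitz_on UNIV (\<lambda>x. b (c *\<^sub>R x + a))"
    proof (rule lipschitz_onI)
      fix x y
      have "dist (b (c *\<^sub>R x + a)) (b (c *\<^sub>R y + a)) \<le> L * dist (c *\<^sub>R x + a) (c *\<^sub>R y + a)"
        by (rule lipschitz_onD[OF lip]) simp_all
      also have "dist (c *\<^sub>R x + a) (c *\<^sub>R y + a) = c * dist x y"
        using c by (simp add: dist_norm flip: scaleR_diff_right)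
      finally show "dist (b (c *\<^sub>R x + a)) (b (c *\<^sub>R y + a)) \<le> L * c * dist x y" by simp
    next
      show "0 \<le> L * c" using c lipschitz_on_nonneg[OF lip] by simp
    qed
    show "gateaux_differentiable_at (\<lambda>x. b (c *\<^sub>R x + a)) x" for x
      using gat by (rule gateaux_differentiable_at_compose_affine)
    show "b (c *\<^sub>R 0 + a) > 0" using a by simp
    show "norm x < r" if "b (c *\<^sub>R x + a) \<noteq> 0" for x
      using R(2)[OF that] R(1) r c by (simp add: dist_norm c_def field_simps)
    show "\<bar>b (c *\<^sub>R x + a)\<bar> \<le> b a + L * R" for x
    proof (cases "b (c *\<^sub>R x + a) = 0")
      case True
      then show ?thesis using a R lipschitz_on_nonneg[OF lip] by simp
    next
      case False
      have "dist (b (c *\<^sub>R x + a)) (b a) \<le> L * dist (c *\<^sub>R x + a) a"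
        by (rule lipschitz_onD[OF lip]) simp_all
      also have "\<dots> \<le> L * R"
        using R(2)[OF False] lipschitz_on_nonneg[OF lip] by (intro mult_left_mono) auto
      finally show ?thesis using nn[of "c *\<^sub>R x + a"] by (simp add: dist_real_def)
    qed
  qed
qed

text \<open>The bump \<open>g n\<close> lives near \<open>q ^ n *\<^sub>R s n\<close>, in an annulus
  around the origin. The annuli are disjoint, so at most one summand is nonzero at any point, which
  gives the global bounds. Away from the origin the sum is locally finite, and at the origin each
  line meets finitely many bumps.\<close>

lemma exists_shrinking_bumps:
  fixes s :: "nat \<Rightarrow> 'x::real_normed_vector" and b :: "'x \<Rightarrow> real"
  assumes b: "bump_function b" and lip: "L-lipschitz_on UNIV b"
    and gat: "\<And>x. gateaux_differentiable_at b x"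
    and e: "e > 0" and sep: "\<And>m n. m \<noteq> n \<Longrightarrow> dist (s m) (s n) \<ge> e"
    and s_ge: "\<And>n. norm (s n) \<ge> e" and s_le: "\<And>n. norm (s n) \<le> M"
  obtains f :: "'x \<Rightarrow> real" and K B \<delta> q where "K-lipschitz_on UNIV f" "\<And>x. \<bar>f x\<bar> \<le> B"
    "\<And>x. gateaux_differentiable_at f x" "f 0 = 0"
    "\<And>h. ((\<lambda>t. f (t *\<^sub>R h) / t) \<longlongrightarrow> 0) (at 0)"
    "\<delta> > 0" "0 < q" "q < 1" "\<And>n. f (q ^ n *\<^sub>R s n) = \<delta> * q ^ n"
proof -
  obtain \<beta> :: "'x \<Rightarrow> real" and L' B where \<beta>_lip: "L'-lipschitz_on UNIV \<beta>"
    and \<beta>_gat: "\<And>x. gateaux_differentiable_at \<beta> x" and \<beta>0: "\<beta> 0 > 0"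
    and \<beta>_supp: "\<And>x. \<beta> x \<noteq> 0 \<Longrightarrow> norm x < e / 4" and \<beta>_bound: "\<And>x. \<bar>\<beta> x\<bar> \<le> B"
    by (rule bump_function_rescale[OF b lip gat, of "e / 4"]) (use e in simp, rule that)
  have M: "M \<ge> e" using s_ge[of 0] s_le[of 0] by linarith
  \<comment> \<open>Chosen so that the outer radius \<open>q ^ Suc n * (M + e)\<close> of one
    annulus equals the inner radius \<open>q ^ n * (e / 4)\<close> of the preceding one.\<close>
  define q where "q = (e / 4) / (M + e)"
  have q: "0 < q" "q < 1" and qM: "q * (M + e) = e / 4"
    using e M by (auto simp: q_def divide_simps)
  \<comment> \<open>Scaling argument and value by the same factor keeps the Lipschitz constant
    \<open>L'\<close>. The argument is written as a sum to match
    \<open>gateaux_differentiable_at_compose_affine\<close>.\<close>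
  define g where "g n x = q ^ n * \<beta> ((1 / q ^ n) *\<^sub>R x + (- s n))" for n x
  define f where "f x = (\<Sum>n. g n x)" for x
  have qn: "q ^ n > 0" for n using q by simp
  have g_supp: "norm ((1 / q ^ n) *\<^sub>R x - s n) < e / 4" if "g n x \<noteq> 0" for n x
    using that \<beta>_supp by (auto simp: g_def)
  have g_annulus: "q ^ n * (e / 4) < norm x \<and> norm x < q ^ n * (M + e)" if "g n x \<noteq> 0" for n x
  proof -
    let ?z = "(1 / q ^ n) *\<^sub>R x"
    have "norm (?z - s n) < e / 4" using g_supp that by blast
    then have "e / 4 < norm ?z" "norm ?z < M + e"
      using norm_triangle_ineq2[of "s n" ?z] norm_triangle_ineq2[of ?z "s n"] s_ge[of n] s_le[of n] e
      by (auto simp: norm_minus_commute)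
    moreover have "norm x = q ^ n * norm ?z" using q qn[of n] by simp
    ultimately show ?thesis using qn[of n] by (simp del: norm_scaleR)
  qed
  have g_disjoint: "m = n" if "g m x \<noteq> 0" "g n x \<noteq> 0" for m n x
  proof -
    have "\<not> m < n" if "g m x \<noteq> 0" "g n x \<noteq> 0" for m n
    proof
      assume "m < n"
      then have "q ^ n \<le> q ^ Suc m" using q by (intro power_decreasing) auto
      then have "q ^ n * (M + e) \<le> q ^ Suc m * (M + e)"
        using M e by (intro mult_right_mono) auto
      also have "\<dots> = q ^ m * (e / 4)" using qM by (simp add: mult.assoc mult.left_commute)
      finally show False using g_annulus[OF that(1)] g_annulus[OF that(2)] by linarith
    qed
    with that show ?thesis by (metis linorder_neqE_nat)
  qed
  have f_sum: "f x = (\<Sum>n\<in>N. g n x)" if "finite N" "\<And>n. n \<notin> N \<Longrightarrow> g n x = 0" for x N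
    unfolding f_def using that by (rule suminf_finite)
  have f_eq: "f x = g n x" if "\<And>m. m \<noteq> n \<Longrightarrow> g m x = 0" for x n
    using f_sum[of "{n}" x] that by simp
  \<comment> \<open>Points outside all bumps are included; any \<open>n\<close> serves for
    them.\<close>
  have f_cases: "\<exists>n. \<forall>m. m \<noteq> n \<longrightarrow> g m x = 0" for x
    using g_disjoint by metis
  have g_gat: "gateaux_differentiable_at (g n) x" for n x
    unfolding g_def
    by (intro gateaux_differentiable_at_cmult gateaux_differentiable_at_compose_affine \<beta>_gat)
  have g_lip: "\<bar>g n x - g n y\<bar> \<le> L' * dist x y" for n x y
  proof -
    let ?z = "\<lambda>x. (1 / q ^ n) *\<^sub>R x + (- s n)"
    have "dist (\<beta> (?z x)) (\<beta> (?z y)) \<le> L' * dist (?z x) (?z y)"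
      by (rule lipschitz_onD[OF \<beta>_lip]) simp_all
    also have "dist (?z x) (?z y) = dist x y / q ^ n"
      using qn[of n] by (simp add: dist_norm flip: scaleR_diff_right)
    finally have "q ^ n * dist (\<beta> (?z x)) (\<beta> (?z y)) \<le> q ^ n * (L' * (dist x y / q ^ n))"
      using qn[of n] by (intro mult_left_mono) auto
    moreover have "\<bar>g n x - g n y\<bar> = q ^ n * dist (\<beta> (?z x)) (\<beta> (?z y))"
      using qn[of n] by (simp add: g_def dist_real_def abs_mult flip: right_diff_distrib)
    ultimately show ?thesis using q(1) by simp
  qed
  have g0: "g n 0 = 0" for n
  proof -
    have "\<not> q ^ n * (e / 4) < norm (0 :: 'x)" using qn[of n] e by (simp add: not_less)
    then show ?thesis using g_annulus[of n 0] by blast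
  qed
  have f0: "f 0 = 0" by (simp add: f_def g0)
  have f_line: "((\<lambda>t. f (t *\<^sub>R h) / t) \<longlongrightarrow> 0) (at 0)" for h
  proof -
    \<comment> \<open>If \<open>t *\<^sub>R h\<close> lies in the support of \<open>g n\<close>,
      then \<open>(t / q ^ n) *\<^sub>R h\<close> lies on this segment and within
      \<open>e / 4\<close> of \<open>s n\<close>. For \<open>h = 0\<close> the radius is
      \<open>0\<close> by the convention for division, and \<open>g0\<close> settles that
      case.\<close>
    have K: "compact ((\<lambda>t. t *\<^sub>R h) ` cball 0 ((M + e) / norm h))"
      by (intro compact_continuous_image continuous_intros) auto
    define N where "N = {n. \<exists>k\<in>(\<lambda>t. t *\<^sub>R h) ` cball 0 ((M + e) / norm h). dist (s n) k < e / 4}"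
    have N: "finite N"
      unfolding N_def using separated_sequence_near_compact_finite[OF e sep K] by simp
    have outside: "g n (t *\<^sub>R h) = 0" if "n \<notin> N" for n t
    proof (rule ccontr)
      assume nz: "g n (t *\<^sub>R h) \<noteq> 0"
      then have "h \<noteq> 0" using g0 by auto
      then have "t / q ^ n \<in> cball 0 ((M + e) / norm h)"
        using g_annulus[OF nz] q qn[of n] by (simp add: field_simps)
      moreover have "dist (s n) ((t / q ^ n) *\<^sub>R h) < e / 4"
        using g_supp[OF nz] by (simp add: dist_norm norm_minus_commute)
      ultimately show False using that by (auto simp: N_def)
    qed
    \<comment> \<open>Each of the finitely many remaining bumps vanishes near the origin, so the
      quotient is exactly \<open>0\<close> for small \<open>t\<close>.\<close>
    have "\<forall>\<^sub>F t in at 0. \<forall>n\<in>N. g n (t *\<^sub>R h) = 0"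
    proof (intro eventually_ball_finite N ballI)
      fix n
      have "\<forall>\<^sub>F t in nhds 0. 0 + t *\<^sub>R h \<in> ball 0 (q ^ n * (e / 4))"
        using e qn[of n] by (intro eventually_line_in_open) auto
      then have "\<forall>\<^sub>F t in at 0. t *\<^sub>R h \<in> ball 0 (q ^ n * (e / 4))"
        by (simp add: eventually_nhds_conv_at)
      then show "\<forall>\<^sub>F t in at 0. g n (t *\<^sub>R h) = 0"
        by eventually_elim (use g_annulus in force)
    qed
    then have "\<forall>\<^sub>F t in at 0. f (t *\<^sub>R h) / t = 0"
      by eventually_elim (use f_sum[OF N outside] in auto)
    then show ?thesis by (rule tendsto_eventually)
  qed
  have f_gat: "gateaux_differentiable_at f x" for x
  proof (cases "x = 0")
    case True
    then show ?thesis
      using f_line f0 unfolding gateaux_differentiable_at_def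
      by (intro exI[of _ "\<lambda>_. 0"]) auto
  next
    case False
    \<comment> \<open>All bumps of index at least \<open>N\<close> lie within distance
      \<open>norm x / 2\<close> of the origin, so near \<open>x\<close> the function is a finite
      sum.\<close>
    obtain N where N: "q ^ N < norm x / 2 / (M + e)"
      using real_arch_pow_inv[of "norm x / 2 / (M + e)" q] False M e q by auto
    have Nx: "q ^ N * (M + e) < norm x / 2"
      using N M e pos_less_divide_eq[of "M + e" "q ^ N" "norm x / 2"] by linarith
    show ?thesis
    proof (rule gateaux_differentiable_at_transform_open)
      show "gateaux_differentiable_at (\<lambda>x. \<Sum>n<N. g n x) x"
        by (intro gateaux_differentiable_at_sum g_gat)
      show "open (- cball 0 (norm x / 2) :: 'x set)" by (simp add: open_Compl)
      show "x \<in> - cball 0 (norm x / 2)" using False by simp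
      fix z :: 'x assume z: "z \<in> - cball 0 (norm x / 2)"
      have "g n z = 0" if "n \<notin> {..<N}" for n
      proof (rule ccontr)
        assume "g n z \<noteq> 0"
        then have "norm z < q ^ n * (M + e)" using g_annulus by blast
        also have "q ^ n * (M + e) \<le> q ^ N * (M + e)"
          using that q M e by (intro mult_right_mono power_decreasing) auto
        finally show False using Nx z by simp
      qed
      then show "(\<Sum>n<N. g n z) = f z" using f_sum[of "{..<N}" z] by simp
    qed
  qed
  have f_lip: "(2 * L')-lipschitz_on UNIV f"
  proof (rule lipschitz_onI)
    fix x y
    obtain m n where mx: "\<And>k. k \<noteq> m \<Longrightarrow> g k x = 0" and ny: "\<And>k. k \<noteq> n \<Longrightarrow> g k y = 0"
      using f_cases by metis
    have "f x = g m x" "f y = g n y" using f_eq mx ny by auto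
    show "dist (f x) (f y) \<le> 2 * L' * dist x y"
    proof (cases "m = n")
      case True
      then show ?thesis
        using g_lip[of n x y] \<open>f x = g m x\<close> \<open>f y = g n y\<close> by (simp add: dist_real_def)
    next
      case False
      \<comment> \<open>The two inserted terms \<open>g m y\<close> and \<open>g n x\<close> vanish;
        splitting into two differences is the source of the factor \<open>2\<close>.\<close>
      then have "f x - f y = (g m x - g m y) + (g n x - g n y)"
        using mx[of n] ny[of m] \<open>f x = g m x\<close> \<open>f y = g n y\<close> by simp
      then show ?thesis
        using g_lip[of m x y] g_lip[of n x y] by (simp add: dist_real_def)
    qed
  next
    show "0 \<le> 2 * L'" using lipschitz_on_nonneg[OF \<beta>_lip] by simp
  qed
  have f_bound: "\<bar>f x\<bar> \<le> B" for x
  proof -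
    obtain n where "f x = g n x" using f_cases[of x] f_eq by blast
    moreover have "\<bar>g n x\<bar> \<le> 1 * B"
      unfolding g_def abs_mult using q \<beta>_bound by (intro mult_mono) (auto simp: power_le_one)
    ultimately show ?thesis by simp
  qed
  have f_centre: "f (q ^ n *\<^sub>R s n) = \<beta> 0 * q ^ n" for n
  proof -
    have "g n (q ^ n *\<^sub>R s n) = \<beta> 0 * q ^ n" using qn[of n] q by (simp add: g_def)
    moreover from this have "g n (q ^ n *\<^sub>R s n) \<noteq> 0" using \<beta>0 q by simp
    ultimately show ?thesis using f_eq[of n] g_disjoint by metis
  qed
  show thesis
    using f_lip f_bound f_gat f0 f_line \<beta>0 q f_centre by (rule that)
qed

section \<open>Failure of Frechet differentiability, and the equivalence\<close>

text \<open>A Frechet derivative at \<open>y\<close> would have to be \<open>0\<close>, since along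
  every line the difference quotients of the sum of bumps tend to \<open>0\<close>. Yet increments
  \<open>q ^ n *\<^sub>R v n\<close> of norm at most \<open>q ^ n\<close> produce the values
  \<open>\<delta> * q ^ n\<close>.\<close>

lemma noncompact_operator_imp_nondifferentiable:
  fixes T :: "'y::real_normed_vector \<Rightarrow> 'x::banach" and b :: "'x \<Rightarrow> real"
  assumes T: "bounded_linear T" "\<not> compact_operator T"
    and b: "bump_function b" "L-lipschitz_on UNIV b" "\<And>x. gateaux_differentiable_at b x"
  obtains f :: "'x \<Rightarrow> real" and K where "bounded (range f)" "K-lipschitz_on UNIV f"
    "\<And>x. gateaux_differentiable_at f x" "\<not> (f \<circ> T) differentiable (at y)"
proof -
  interpret T: bounded_linear T by (fact T(1))
  obtain M where M: "M > 0" "\<And>v. norm (T v) \<le> norm v * M" using T.pos_bounded by blast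
  have "\<not> compact (closure (T ` cball 0 1))" using T by (simp add: compact_operator_def)
  then obtain s :: "nat \<Rightarrow> 'x" and e where e: "e > 0" and s: "range s \<subseteq> T ` cball 0 1" "\<And>n. norm (s n) \<ge> e"
    "\<And>m n. m \<noteq> n \<Longrightarrow> dist (s m) (s n) \<ge> e"
    by (rule not_compact_closure_imp_separated_sequence) blast
  have "\<forall>n. \<exists>v. norm v \<le> 1 \<and> s n = T v" using s(1) by (fastforce simp: image_subset_iff)
  then obtain v where v: "\<And>n. norm (v n) \<le> 1" "\<And>n. s n = T (v n)" by metis
  have s_le: "norm (s n) \<le> M" for n
  proof -
    have "norm (v n) * M \<le> 1 * M" using v(1) M(1) by (intro mult_right_mono) auto
    then show ?thesis using M(2)[of "v n"] v(2) by simp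
  qed
  obtain F :: "'x \<Rightarrow> real" and K B \<delta> q where F: "K-lipschitz_on UNIV F" "\<And>x. \<bar>F x\<bar> \<le> B"
    "\<And>x. gateaux_differentiable_at F x" "F 0 = 0"
    and line: "\<And>h. ((\<lambda>t. F (t *\<^sub>R h) / t) \<longlongrightarrow> 0) (at 0)"
    and \<delta>: "\<delta> > 0" and q: "0 < q" "q < 1" and centre: "\<And>n. F (q ^ n *\<^sub>R s n) = \<delta> * q ^ n"
    by (rule exists_shrinking_bumps[OF b e s(3,2) s_le]) (assumption, rule that)
  \<comment> \<open>The translation carries the accumulation point of the bumps from the origin to
    \<open>T y\<close>; the factor \<open>1\<close> fits the affine composition lemma.\<close>
  let ?f = "\<lambda>x. F (1 *\<^sub>R x + (- T y))"
  have shift: "(?f \<circ> T) (y + h) = F (T h)" for h by (simp add: T.add)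
  have "\<not> (?f \<circ> T) differentiable (at y)"
  proof
    assume "(?f \<circ> T) differentiable (at y)"
    then obtain D where D: "((?f \<circ> T) has_derivative D) (at y)"
      by (auto simp: differentiable_def)
    interpret D: bounded_linear D using D by (rule has_derivative_bounded_linear)
    have D0: "D h = 0" for h
    proof -
      have "((\<lambda>t. y + t *\<^sub>R h) has_derivative (\<lambda>t. t *\<^sub>R h)) (at 0)"
        by (auto intro!: derivative_eq_intros)
      moreover have "((?f \<circ> T) has_derivative D) (at (y + 0 *\<^sub>R h))" using D by simp
      ultimately have "((?f \<circ> T) \<circ> (\<lambda>t. y + t *\<^sub>R h) has_derivative D \<circ> (\<lambda>t. t *\<^sub>R h)) (at 0)"
        by (rule diff_chain_at)
      moreover have "(?f \<circ> T) \<circ> (\<lambda>t. y + t *\<^sub>R h) = (\<lambda>t. F (t *\<^sub>R T h))"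
        by (simp add: fun_eq_iff T.add T.scaleR)
      moreover have "D \<circ> (\<lambda>t. t *\<^sub>R h) = (*) (D h)" by (auto simp: D.scaleR mult.commute)
      ultimately have "((\<lambda>t. F (t *\<^sub>R T h)) has_real_derivative D h) (at 0)"
        by (simp add: has_field_derivative_def)
      then have "((\<lambda>t. F (t *\<^sub>R T h) / t) \<longlongrightarrow> D h) (at 0)" by (simp add: DERIV_def F(4))
      then show ?thesis using line[of "T h"] tendsto_unique[OF at_neq_bot] by blast
    qed
    \<comment> \<open>Any tolerance below \<open>\<delta>\<close> contradicts the height
      \<open>\<delta> * q ^ n\<close> at the centres.\<close>
    have "\<delta> / 2 > 0" using \<delta> by simp
    then obtain d where d: "d > 0" "\<And>z. norm (z - y) < d \<Longrightarrow>
        norm ((?f \<circ> T) z - (?f \<circ> T) y - D (z - y)) \<le> \<delta> / 2 * norm (z - y)"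
      using D unfolding has_derivative_at_alt by blast
    obtain n where n: "q ^ n < d" using real_arch_pow_inv[OF d(1) q(2)] by blast
    let ?h = "q ^ n *\<^sub>R v n"
    have h: "norm ?h \<le> q ^ n" using v(1)[of n] q by (simp add: mult_left_le)
    have "\<bar>F (T ?h)\<bar> \<le> \<delta> / 2 * norm ?h"
      using d(2)[of "y + ?h"] h n shift[of ?h] shift[of 0] D0 F(4) by (simp add: T.zero)
    also have "\<dots> \<le> \<delta> / 2 * q ^ n" using h \<delta> by (intro mult_left_mono) auto
    also have "F (T ?h) = \<delta> * q ^ n" using centre v(2) by (simp add: T.scaleR)
    finally show False using \<delta> q by simp
  qed
  moreover have "bounded (range ?f)" using F(2) by (auto simp: bounded_iff)
  moreover have "K-lipschitz_on UNIV ?f"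
  proof (rule lipschitz_onI)
    show "dist (?f x) (?f z) \<le> K * dist x z" for x z
      using lipschitz_onD[OF F(1), of "x - T y" "z - T y"] by (simp add: dist_norm)
    show "0 \<le> K" using F(1) by (rule lipschitz_on_nonneg)
  qed
  moreover have "gateaux_differentiable_at ?f x" for x
    by (intro gateaux_differentiable_at_compose_affine F(3))
  ultimately show thesis using that by blast
qed

theorem theorem3p10:
  fixes T :: "'y::banach \<Rightarrow> 'x::banach" and U :: "'x set"
  assumes "open U"
    and "T -` U \<noteq> {}"
    and "bounded_linear T"
    and "\<exists>b :: 'x \<Rightarrow> real. bump_function b \<and> (\<exists>L. L-lipschitz_on UNIV b) \<and>
           (\<forall>x. gateaux_differentiable_at b x)"
  shows "compact_operator T \<longleftrightarrow>
    (\<forall>f :: 'x \<Rightarrow> real.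
        bounded (f ` U) \<and> (\<exists>L. L-lipschitz_on U f) \<and>
        (\<forall>x\<in>U. gateaux_differentiable_at f x) \<longrightarrow>
        (\<forall>y \<in> T -` U. (f \<circ> T) differentiable (at y)))"
proof
  assume "compact_operator T"
  with \<open>open U\<close> show "\<forall>f :: 'x \<Rightarrow> real.
        bounded (f ` U) \<and> (\<exists>L. L-lipschitz_on U f) \<and>
        (\<forall>x\<in>U. gateaux_differentiable_at f x) \<longrightarrow>
        (\<forall>y \<in> T -` U. (f \<circ> T) differentiable (at y))"
    by (auto intro: compact_operator_gateaux_imp_differentiable)
next
  assume *: "\<forall>f :: 'x \<Rightarrow> real.
        bounded (f ` U) \<and> (\<exists>L. L-lipschitz_on U f) \<and>
        (\<forall>x\<in>U. gateaux_differentiable_at f x) \<longrightarrow>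
        (\<forall>y \<in> T -` U. (f \<circ> T) differentiable (at y))"
  \<comment> \<open>With an empty preimage the right-hand side would hold vacuously for every
    \<open>T\<close>. The point \<open>y\<close> is where differentiability is made to fail.\<close>
  from assms(2) obtain y where y: "y \<in> T -` U" by blast
  from assms(4) obtain b :: "'x \<Rightarrow> real" and L where b: "bump_function b"
    "L-lipschitz_on UNIV b" "\<And>x. gateaux_differentiable_at b x" by blast
  show "compact_operator T"
  proof (rule ccontr)
    assume "\<not> compact_operator T"
    then obtain f :: "'x \<Rightarrow> real" and K where f: "bounded (range f)" "K-lipschitz_on UNIV f"
      "\<And>x. gateaux_differentiable_at f x" "\<not> (f \<circ> T) differentiable (at y)"
      using noncompact_operator_imp_nondifferentiable[OF assms(3) _ b] by blast
    have "bounded (f ` U)" using f(1) by (rule bounded_subset) auto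
    moreover have "K-lipschitz_on U f" using f(2) by (rule lipschitz_on_subset) auto
    ultimately show False using * f(3,4) y by blast
  qed
qed

end
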